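(* The contravariant functors $\mathsf P:\mathbf{Set}\to\mathbf{Caba}$ and $\mathsf A:\mathbf{Caba}\to\mathbf{Set}$ are dual equivalences.
   Context: $\mathbf{Set}$ is the category of sets and functions; $\mathbf{Caba}$ is the category of complete atomic Boolean algebras and complete Boolean homomorphisms; $\mathbf 2=\{0,1\}$ is the two-element Boolean algebra; $\mathrm{At}(B)$ is the set of atoms of $B$. The contravariant functor $\mathsf P$ sends a set $X$ to its power set algebra $\mathsf P(X)$ and $f:X\to Y$ to $\mathsf P(f):\mathsf P(Y)\to\mathsf P(X)$, $M\mapsto f^{-1}(M)$. For $B\in\mathbf{Caba}$ and $x\in\mathrm{At}(B)$ let $\check x:B\to\mathbf 2$ be given by $\check x(b)=1\Leftrightarrow x\le b$. The contravariant functor $\mathsf A$ sends $B$ to the set $\check X_B=\{\check x\mid x\in\mathrm{At}(B)\}$ and $\sigma:B\to B'$ to the function $\mathsf A(\sigma)=f^\sigma:\check X_{B'}\to\check X_B$, $f^\sigma(\check y)=\check y\circ\sigma$ for $\check y\in\check X_{B'}$ (one has $\check y\circ\sigma\in\check X_B$). A contravariant functor is a dual equivalence if there is a contravariant functor in the opposite direction such that both composites are naturally isomorphic to the identity functors; here $\mathsf P\circ\mathsf A\cong \mathrm{Id}_{\mathbf{Caba}}$ and $\mathsf A\circ\mathsf P\cong\mathrm{Id}_{\mathbf{Set}}$. *)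

theory Defs
  imports "HOL-Algebra.Complete_Lattice" "HOL-Library.FuncSet"
begin

section \<open>Categories, contravariant functors, dual equivalences\<close>

record ('o, 'm) cat =
  Obj :: "'o set"
  Arr :: "'m set"
  Dom :: "'m \<Rightarrow> 'o"
  Cod :: "'m \<Rightarrow> 'o"
  Ident :: "'o \<Rightarrow> 'm"
  Comp :: "'m \<Rightarrow> 'm \<Rightarrow> 'm"  \<comment> \<open>\<open>Comp C g f\<close> is \<open>g\<close> after \<open>f\<close>\<close>

definition Hom :: "('o, 'm) cat \<Rightarrow> 'o \<Rightarrow> 'o \<Rightarrow> 'm set" where
  "Hom C X Y = {f \<in> Arr C. Dom C f = X \<and> Cod C f = Y}"

locale category =
  fixes C :: "('o, 'm) cat"
  assumes Dom_Obj: "f \<in> Arr C \<Longrightarrow> Dom C f \<in> Obj C"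
    and Cod_Obj: "f \<in> Arr C \<Longrightarrow> Cod C f \<in> Obj C"
    and Ident_Hom: "X \<in> Obj C \<Longrightarrow> Ident C X \<in> Hom C X X"
    and Comp_Hom: "f \<in> Hom C X Y \<Longrightarrow> g \<in> Hom C Y Z \<Longrightarrow> Comp C g f \<in> Hom C X Z"
    and Comp_Ident: "f \<in> Hom C X Y \<Longrightarrow> Comp C f (Ident C X) = f"
    and Ident_Comp: "f \<in> Hom C X Y \<Longrightarrow> Comp C (Ident C Y) f = f"
    and Comp_assoc: "f \<in> Hom C W X \<Longrightarrow> g \<in> Hom C X Y \<Longrightarrow> h \<in> Hom C Y Z \<Longrightarrow>
      Comp C h (Comp C g f) = Comp C (Comp C h g) f"

record ('o, 'm, 'p, 'n) functor_data =
  OMap :: "'o \<Rightarrow> 'p"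
  AMap :: "'m \<Rightarrow> 'n"

locale covariant_functor = C: category C + D: category D
  for C :: "('o, 'm) cat" and D :: "('p, 'n) cat" +
  fixes F :: "('o, 'm, 'p, 'n) functor_data"
  assumes OMap_Obj: "X \<in> Obj C \<Longrightarrow> OMap F X \<in> Obj D"
    and AMap_Hom: "f \<in> Hom C X Y \<Longrightarrow> AMap F f \<in> Hom D (OMap F X) (OMap F Y)"
    and AMap_Ident: "X \<in> Obj C \<Longrightarrow> AMap F (Ident C X) = Ident D (OMap F X)"
    and AMap_Comp: "f \<in> Hom C X Y \<Longrightarrow> g \<in> Hom C Y Z \<Longrightarrow>
      AMap F (Comp C g f) = Comp D (AMap F g) (AMap F f)"

locale contravariant_functor = C: category C + D: category D
  for C :: "('o, 'm) cat" and D :: "('p, 'n) cat" +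
  fixes F :: "('o, 'm, 'p, 'n) functor_data"
  assumes OMap_Obj: "X \<in> Obj C \<Longrightarrow> OMap F X \<in> Obj D"
    and AMap_Hom: "f \<in> Hom C X Y \<Longrightarrow> AMap F f \<in> Hom D (OMap F Y) (OMap F X)"
    and AMap_Ident: "X \<in> Obj C \<Longrightarrow> AMap F (Ident C X) = Ident D (OMap F X)"
    and AMap_Comp: "f \<in> Hom C X Y \<Longrightarrow> g \<in> Hom C Y Z \<Longrightarrow>
      AMap F (Comp C g f) = Comp D (AMap F f) (AMap F g)"

definition id_functor :: "('o, 'm, 'o, 'm) functor_data" where
  "id_functor = \<lparr>OMap = (\<lambda>X. X), AMap = (\<lambda>f. f)\<rparr>"

definition comp_functor ::
  "('p, 'n, 'q, 'l) functor_data \<Rightarrow> ('o, 'm, 'p, 'n) functor_data \<Rightarrow> ('o, 'm, 'q, 'l) functor_data"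
  where
  "comp_functor G F = \<lparr>OMap = OMap G \<circ> OMap F, AMap = AMap G \<circ> AMap F\<rparr>"

definition iso_arrow :: "('o, 'm) cat \<Rightarrow> 'm \<Rightarrow> bool" where
  "iso_arrow C f \<longleftrightarrow> f \<in> Arr C \<and> (\<exists>g \<in> Hom C (Cod C f) (Dom C f).
     Comp C g f = Ident C (Dom C f) \<and> Comp C f g = Ident C (Cod C f))"

definition naturally_isomorphic ::
  "('o, 'm) cat \<Rightarrow> ('p, 'n) cat \<Rightarrow> ('o, 'm, 'p, 'n) functor_data \<Rightarrow>
   ('o, 'm, 'p, 'n) functor_data \<Rightarrow> bool" where
  "naturally_isomorphic C D F G \<longleftrightarrow>
     covariant_functor C D F \<and> covariant_functor C D G \<and>
     (\<exists>\<eta>. (\<forall>X \<in> Obj C. \<eta> X \<in> Hom D (OMap F X) (OMap G X) \<and> iso_arrow D (\<eta> X)) \<and>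
          (\<forall>X Y. \<forall>f \<in> Hom C X Y. Comp D (AMap G f) (\<eta> X) = Comp D (\<eta> Y) (AMap F f)))"

definition dually_quasi_inverse ::
  "('o, 'm) cat \<Rightarrow> ('p, 'n) cat \<Rightarrow> ('o, 'm, 'p, 'n) functor_data \<Rightarrow>
   ('p, 'n, 'o, 'm) functor_data \<Rightarrow> bool" where
  "dually_quasi_inverse C D F G \<longleftrightarrow>
     naturally_isomorphic C C (comp_functor G F) id_functor \<and>
     naturally_isomorphic D D (comp_functor F G) id_functor"

definition dual_equivalence ::
  "('o, 'm) cat \<Rightarrow> ('p, 'n) cat \<Rightarrow> ('o, 'm, 'p, 'n) functor_data \<Rightarrow> bool" where
  "dual_equivalence C D F \<longleftrightarrow> contravariant_functor C D F \<and>
     (\<exists>G. contravariant_functor D C G \<and> dually_quasi_inverse C D F G)"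

section \<open>Universes of sets\<close>

text \<open>
  No HOL type contains the power sets of all its subsets, so the category of sets is formed
  inside a universe: a type \<open>'u\<close> of sets in which \<open>elts x\<close> is the collection of the members
  of \<open>x\<close>.  The axioms are extensionality, separation,
  pairing, union, power set and (second-order) replacement; every model of ZF with second-order
  replacement satisfies them, as does the universe of all ZFC sets.  Infinity and foundation are
  not needed and hence not imposed.
\<close>

definition small :: "('u \<Rightarrow> 'u set) \<Rightarrow> 'u set \<Rightarrow> bool" where
  "small elts S \<longleftrightarrow> S \<in> range elts"

locale set_universe =
  fixes elts :: "'u \<Rightarrow> 'u set"
  assumes extensionality: "elts x = elts y \<Longrightarrow> x = y"
    and separation: "S \<subseteq> elts x \<Longrightarrow> small elts S"
    and pairing: "small elts {x, y}"
    and union: "small elts (\<Union>y \<in> elts x. elts y)"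
    and power_set: "small elts {y. elts y \<subseteq> elts x}"
    and replacement: "small elts (f ` elts x)"

definition vset :: "('u \<Rightarrow> 'u set) \<Rightarrow> 'u set \<Rightarrow> 'u" where
  "vset elts S = (THE x. elts x = S)"

definition vzero :: "('u \<Rightarrow> 'u set) \<Rightarrow> 'u" where
  "vzero elts = vset elts {}"

definition vone :: "('u \<Rightarrow> 'u set) \<Rightarrow> 'u" where
  "vone elts = vset elts {vzero elts}"

definition vpair :: "('u \<Rightarrow> 'u set) \<Rightarrow> 'u \<Rightarrow> 'u \<Rightarrow> 'u" where
  "vpair elts x y = vset elts {vset elts {x}, vset elts {x, y}}"

text \<open>Functions that are themselves members of the universe are represented by their graphs.\<close>

definition vgraph :: "('u \<Rightarrow> 'u set) \<Rightarrow> 'u set \<Rightarrow> ('u \<Rightarrow> 'u) \<Rightarrow> 'u" where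
  "vgraph elts X f = vset elts ((\<lambda>x. vpair elts x (f x)) ` X)"

definition vapp :: "('u \<Rightarrow> 'u set) \<Rightarrow> 'u \<Rightarrow> 'u \<Rightarrow> 'u" where
  "vapp elts g x = (THE y. vpair elts x y \<in> elts g)"

section \<open>The categories of sets and of complete atomic Boolean algebras\<close>

datatype ('o, 'u) arrow = Arrow (src: 'o) (fn: "'u \<Rightarrow> 'u") (tgt: 'o)

definition SET :: "('u \<Rightarrow> 'u set) \<Rightarrow> ('u set, ('u set, 'u) arrow) cat" where
  "SET elts =
    \<lparr>Obj = {X. small elts X},
     Arr = {Arrow X f Y | X f Y. small elts X \<and> small elts Y \<and> f \<in> X \<rightarrow>\<^sub>E Y},
     Dom = src,
     Cod = tgt,
     Ident = (\<lambda>X. Arrow X (\<lambda>x \<in> X. x) X),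
     Comp = (\<lambda>g f. Arrow (src f) (compose (src f) (fn g) (fn f)) (tgt g))\<rparr>"

definition is_complement :: "'a gorder \<Rightarrow> 'a \<Rightarrow> 'a \<Rightarrow> bool" where
  "is_complement B x y \<longleftrightarrow> x \<in> carrier B \<and> y \<in> carrier B \<and>
     x \<sqinter>\<^bsub>B\<^esub> y = \<bottom>\<^bsub>B\<^esub> \<and> x \<squnion>\<^bsub>B\<^esub> y = \<top>\<^bsub>B\<^esub>"

definition At :: "'a gorder \<Rightarrow> 'a set" where
  "At B = {x \<in> carrier B. x \<noteq> \<bottom>\<^bsub>B\<^esub> \<and> (\<forall>y \<in> carrier B. y \<sqsubseteq>\<^bsub>B\<^esub> x \<longrightarrow> y = \<bottom>\<^bsub>B\<^esub> \<or> y = x)}"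

text \<open>
  The one-element algebra is included (it is the power set algebra of the empty set).
  The last assumption makes an algebra determined by its carrier and the order on the carrier.
\<close>

locale caba = complete_lattice B for B :: "'a gorder" (structure) +
  assumes distrib: "x \<in> carrier B \<Longrightarrow> y \<in> carrier B \<Longrightarrow> z \<in> carrier B \<Longrightarrow>
      x \<sqinter> (y \<squnion> z) = (x \<sqinter> y) \<squnion> (x \<sqinter> z)"
    and complemented: "x \<in> carrier B \<Longrightarrow> \<exists>y. is_complement B x y"
    and atomic: "x \<in> carrier B \<Longrightarrow> x \<noteq> \<bottom> \<Longrightarrow> \<exists>a \<in> At B. a \<sqsubseteq> x"
    and le_carrier: "x \<sqsubseteq> y \<Longrightarrow> x \<in> carrier B \<and> y \<in> carrier B"

definition complete_boolean_hom :: "'a gorder \<Rightarrow> 'a gorder \<Rightarrow> ('a \<Rightarrow> 'a) \<Rightarrow> bool" where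
  "complete_boolean_hom B B' \<sigma> \<longleftrightarrow> \<sigma> \<in> carrier B \<rightarrow> carrier B' \<and>
     sup_pres B B' \<sigma> \<and> inf_pres B B' \<sigma> \<and>
     (\<forall>x y. is_complement B x y \<longrightarrow> is_complement B' (\<sigma> x) (\<sigma> y))"

definition CABA :: "('u \<Rightarrow> 'u set) \<Rightarrow> ('u gorder, ('u gorder, 'u) arrow) cat" where
  "CABA elts =
    \<lparr>Obj = {B. small elts (carrier B) \<and> caba B},
     Arr = {Arrow B \<sigma> B' | B \<sigma> B'.
       small elts (carrier B) \<and> caba B \<and> small elts (carrier B') \<and> caba B' \<and>
       \<sigma> \<in> extensional (carrier B) \<and> complete_boolean_hom B B' \<sigma>},
     Dom = src,
     Cod = tgt,
     Ident = (\<lambda>B. Arrow B (\<lambda>x \<in> carrier B. x) B),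
     Comp = (\<lambda>g f. Arrow (src f) (compose (carrier (src f)) (fn g) (fn f)) (tgt g))\<rparr>"

section \<open>The functors\<close>

definition powalg :: "('u \<Rightarrow> 'u set) \<Rightarrow> 'u set \<Rightarrow> 'u gorder" where
  "powalg elts X =
    \<lparr>carrier = {M. elts M \<subseteq> X},
     eq = (=),
     le = (\<lambda>M N. elts M \<subseteq> elts N \<and> elts N \<subseteq> X)\<rparr>"

definition PF :: "('u \<Rightarrow> 'u set) \<Rightarrow>
    ('u set, ('u set, 'u) arrow, 'u gorder, ('u gorder, 'u) arrow) functor_data" where
  "PF elts =
    \<lparr>OMap = powalg elts,
     AMap = (\<lambda>f. Arrow (powalg elts (tgt f))
       (\<lambda>M \<in> carrier (powalg elts (tgt f)). vset elts {x \<in> src f. fn f x \<in> elts M})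
       (powalg elts (src f)))\<rparr>"

definition check :: "('u \<Rightarrow> 'u set) \<Rightarrow> 'u gorder \<Rightarrow> 'u \<Rightarrow> 'u" where
  "check elts B x = vgraph elts (carrier B) (\<lambda>b. if x \<sqsubseteq>\<^bsub>B\<^esub> b then vone elts else vzero elts)"

definition check_set :: "('u \<Rightarrow> 'u set) \<Rightarrow> 'u gorder \<Rightarrow> 'u set" where
  "check_set elts B = check elts B ` At B"

text \<open>On arrows, \<open>\<phi>\<close> is sent to (the graph of) the composite of \<open>\<phi>\<close> with the homomorphism.\<close>

definition AF :: "('u \<Rightarrow> 'u set) \<Rightarrow>
    ('u gorder, ('u gorder, 'u) arrow, 'u set, ('u set, 'u) arrow) functor_data" where
  "AF elts =
    \<lparr>OMap = check_set elts,
     AMap = (\<lambda>\<sigma>. Arrow (check_set elts (tgt \<sigma>))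
       (\<lambda>\<phi> \<in> check_set elts (tgt \<sigma>).
          vgraph elts (carrier (src \<sigma>)) (\<lambda>b. vapp elts \<phi> (fn \<sigma> b)))
       (check_set elts (src \<sigma>)))\<rparr>"

end

theory Submission
  imports Defs
begin

text \<open>
  In a complete atomic Boolean algebra \<open>B\<close> an atom below the supremum of a set lies below a member
  of that set, and an element is determined by the atoms below it.  Hence sending \<open>b\<close> to the set of
  all \<open>check x\<close> with \<open>x\<close> an atom below \<open>b\<close> is an order isomorphism from \<open>B\<close> onto \<open>P (A B)\<close>.  The atoms
  of a power set algebra are the singletons, so \<open>x \<mapsto> check {x}\<close> is a bijection from \<open>X\<close> onto
  \<open>A (P X)\<close>.  Naturality rests on the left adjoint of a complete homomorphism \<open>\<sigma>\<close>, which takes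
  atoms to atoms: for every atom \<open>y\<close> there is an atom \<open>x\<close> such that \<open>y \<sqsubseteq> \<sigma> b\<close> iff \<open>x \<sqsubseteq> b\<close>.
\<close>

section \<open>Contravariant functors and natural isomorphisms\<close>

lemma (in category) Hom_Obj: "f \<in> Hom C X Y \<Longrightarrow> X \<in> Obj C \<and> Y \<in> Obj C"
  using Dom_Obj Cod_Obj by (auto simp: Hom_def)

lemma iso_arrow_iff:
  assumes "f \<in> Hom C X Y"
  shows "iso_arrow C f \<longleftrightarrow> (\<exists>g \<in> Hom C Y X. Comp C g f = Ident C X \<and> Comp C f g = Ident C Y)"
  using assms by (auto simp: iso_arrow_def Hom_def)

lemma covariant_id_functor:
  assumes "category C"
  shows "covariant_functor C C id_functor"
proof -
  interpret category C by fact
  show ?thesis by unfold_locales (auto simp: id_functor_def)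
qed

lemma covariant_comp_functor:
  assumes "contravariant_functor C D F" "contravariant_functor D E G"
  shows "covariant_functor C E (comp_functor G F)"
proof -
  interpret F: contravariant_functor C D F by fact
  interpret G: contravariant_functor D E G by fact
  show ?thesis
  proof
    fix f g X Y Z assume "f \<in> Hom C X Y" "g \<in> Hom C Y Z"
    then show "AMap (comp_functor G F) (Comp C g f)
        = Comp E (AMap (comp_functor G F) g) (AMap (comp_functor G F) f)"
      by (simp add: comp_functor_def F.AMap_Comp G.AMap_Comp[OF F.AMap_Hom F.AMap_Hom])
  qed (auto simp: comp_functor_def F.OMap_Obj G.OMap_Obj F.AMap_Ident G.AMap_Ident
      intro: F.AMap_Hom G.AMap_Hom)
qed

text \<open>The inverses of the components of \<eta> are again natural, because a naturality square
  of \<eta> can be composed with them on both sides.\<close>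

lemma naturally_isomorphic_sym:
  assumes "naturally_isomorphic C D F G"
  shows "naturally_isomorphic C D G F"
proof -
  interpret F: covariant_functor C D F using assms by (simp add: naturally_isomorphic_def)
  interpret G: covariant_functor C D G using assms by (simp add: naturally_isomorphic_def)
  obtain \<eta> where \<eta>: "\<And>X. X \<in> Obj C \<Longrightarrow> \<eta> X \<in> Hom D (OMap F X) (OMap G X)"
    and iso: "\<And>X. X \<in> Obj C \<Longrightarrow> iso_arrow D (\<eta> X)"
    and nat: "\<And>X Y f. f \<in> Hom C X Y \<Longrightarrow> Comp D (AMap G f) (\<eta> X) = Comp D (\<eta> Y) (AMap F f)"
    using assms unfolding naturally_isomorphic_def by metis
  have "\<forall>X \<in> Obj C. \<exists>g. g \<in> Hom D (OMap G X) (OMap F X) \<and>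
      Comp D g (\<eta> X) = Ident D (OMap F X) \<and> Comp D (\<eta> X) g = Ident D (OMap G X)"
    using iso iso_arrow_iff[OF \<eta>] by blast
  then obtain \<theta> where "\<forall>X \<in> Obj C. \<theta> X \<in> Hom D (OMap G X) (OMap F X) \<and>
      Comp D (\<theta> X) (\<eta> X) = Ident D (OMap F X) \<and> Comp D (\<eta> X) (\<theta> X) = Ident D (OMap G X)"
    by (rule bchoice[elim_format]) blast
  then have \<theta>: "\<And>X. X \<in> Obj C \<Longrightarrow> \<theta> X \<in> Hom D (OMap G X) (OMap F X)"
    and \<theta>\<eta>: "\<And>X. X \<in> Obj C \<Longrightarrow> Comp D (\<theta> X) (\<eta> X) = Ident D (OMap F X)"
    and \<eta>\<theta>: "\<And>X. X \<in> Obj C \<Longrightarrow> Comp D (\<eta> X) (\<theta> X) = Ident D (OMap G X)"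
    by auto
  have "iso_arrow D (\<theta> X)" if "X \<in> Obj C" for X
    using \<theta>[OF that] \<eta>[OF that] \<theta>\<eta>[OF that] \<eta>\<theta>[OF that] by (auto simp: iso_arrow_iff)
  moreover have "Comp D (AMap F f) (\<theta> X) = Comp D (\<theta> Y) (AMap G f)" if f: "f \<in> Hom C X Y" for f X Y
  proof -
    have X: "X \<in> Obj C" and Y: "Y \<in> Obj C" using F.C.Hom_Obj[OF f] by auto
    note Ff = F.AMap_Hom[OF f] and Gf = G.AMap_Hom[OF f]
    have F\<theta>: "Comp D (AMap F f) (\<theta> X) \<in> Hom D (OMap G X) (OMap F Y)"
      by (rule F.D.Comp_Hom[OF \<theta>[OF X] Ff])
    \<comment> \<open>The identity is expanded as \<open>\<theta> Y\<close> after
      \<open>\<eta> Y\<close>, naturality moves \<open>\<eta> Y\<close> past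
      \<open>AMap F f\<close>, and the resulting \<open>\<eta> X\<close> cancels against
      \<open>\<theta> X\<close>.\<close>
    have "Comp D (AMap F f) (\<theta> X) = Comp D (Ident D (OMap F Y)) (Comp D (AMap F f) (\<theta> X))"
      by (simp add: F.D.Ident_Comp[OF F\<theta>])
    also have "\<dots> = Comp D (\<theta> Y) (Comp D (\<eta> Y) (Comp D (AMap F f) (\<theta> X)))"
      by (simp add: F.D.Comp_assoc[OF F\<theta> \<eta>[OF Y] \<theta>[OF Y]] \<theta>\<eta>[OF Y])
    also have "Comp D (\<eta> Y) (Comp D (AMap F f) (\<theta> X)) = Comp D (Comp D (AMap G f) (\<eta> X)) (\<theta> X)"
      by (simp add: F.D.Comp_assoc[OF \<theta>[OF X] Ff \<eta>[OF Y]] nat[OF f])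
    also have "\<dots> = AMap G f"
      by (simp add: F.D.Comp_assoc[OF \<theta>[OF X] \<eta>[OF X] Gf, symmetric] \<eta>\<theta>[OF X] F.D.Comp_Ident[OF Gf])
    finally show ?thesis .
  qed
  ultimately show ?thesis
    using \<theta> F.covariant_functor_axioms G.covariant_functor_axioms
    unfolding naturally_isomorphic_def by blast
qed

text \<open>The canonical maps of the duality run from an object into its double dual, while
  \<open>dually_quasi_inverse\<close> asks for isomorphisms in the opposite direction. Symmetry
  bridges the two.\<close>

lemma naturally_isomorphic_id_functorI:
  assumes "category C" "covariant_functor C C F"
    and "\<And>X. X \<in> Obj C \<Longrightarrow> \<eta> X \<in> Hom C X (OMap F X)"
    and "\<And>X. X \<in> Obj C \<Longrightarrow> iso_arrow C (\<eta> X)"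
    and "\<And>f X Y. f \<in> Hom C X Y \<Longrightarrow> Comp C (AMap F f) (\<eta> X) = Comp C (\<eta> Y) f"
  shows "naturally_isomorphic C C F id_functor"
proof (rule naturally_isomorphic_sym)
  show "naturally_isomorphic C C id_functor F"
    unfolding naturally_isomorphic_def
  proof (intro conjI exI[of _ \<eta>] ballI allI)
    show "covariant_functor C C id_functor" "covariant_functor C C F"
      using assms(1,2) by (auto intro: covariant_id_functor)
  next
    fix X assume "X \<in> Obj C"
    then show "\<eta> X \<in> Hom C (OMap id_functor X) (OMap F X)" "iso_arrow C (\<eta> X)"
      using assms(3,4) by (simp_all add: id_functor_def)
  next
    fix X Y f assume "f \<in> Hom C X Y"
    then show "Comp C (AMap F f) (\<eta> X) = Comp C (\<eta> Y) (AMap id_functor f)"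
      using assms(5) by (simp add: id_functor_def)
  qed
qed

lemma dually_quasi_inverse_sym:
  "dually_quasi_inverse C D F G \<Longrightarrow> dually_quasi_inverse D C G F"
  by (simp add: dually_quasi_inverse_def)

section \<open>Sets of a universe\<close>

context set_universe
begin

text \<open>Smallness gives existence and extensionality gives uniqueness for the description in
  \<open>vset\<close>.\<close>

lemma elts_vset: "small elts S \<Longrightarrow> elts (vset elts S) = S"
  unfolding vset_def by (rule theI') (auto simp: small_def intro: extensionality)

lemma vset_elts: "vset elts (elts x) = x"
  using extensionality elts_vset[of "elts x"] by (simp add: small_def)

lemma small_subset: "small elts T \<Longrightarrow> S \<subseteq> T \<Longrightarrow> small elts S"
  using separation by (auto simp: small_def)

lemma small_image: "small elts S \<Longrightarrow> small elts (f ` S)"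
  using replacement by (auto simp: small_def)

lemma small_empty: "small elts {}"
  using separation by blast

lemma small_singleton: "small elts {x}"
  using pairing[of x x] by simp

lemma small_powerset: "small elts X \<Longrightarrow> small elts {M. elts M \<subseteq> X}"
  using power_set by (auto simp: small_def[of _ X])

lemma vset_eq_iff: "small elts S \<Longrightarrow> small elts T \<Longrightarrow> vset elts S = vset elts T \<longleftrightarrow> S = T"
  by (metis elts_vset)

lemma vone_neq_vzero: "vone elts \<noteq> vzero elts"
  by (simp add: vone_def vzero_def vset_eq_iff small_empty small_singleton)

text \<open>These are Kuratowski pairs; \<open>doubleton_eq_iff\<close> also covers the degenerate
  case of two equal components.\<close>

lemma vpair_eq_iff: "vpair elts x y = vpair elts x' y' \<longleftrightarrow> x = x' \<and> y = y'"
  by (auto simp: vpair_def vset_eq_iff pairing small_singleton doubleton_eq_iff)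

lemma elts_vgraph: "small elts X \<Longrightarrow> elts (vgraph elts X f) = (\<lambda>x. vpair elts x (f x)) ` X"
  by (simp add: vgraph_def elts_vset small_image)

text \<open>Injectivity of pairing leaves only one candidate for the value at \<open>x\<close>, so a
  coded function can be evaluated on its domain.\<close>

lemma vapp_vgraph: "small elts X \<Longrightarrow> x \<in> X \<Longrightarrow> vapp elts (vgraph elts X f) x = f x"
  unfolding vapp_def by (rule the_equality) (auto simp: elts_vgraph vpair_eq_iff)

text \<open>Values are read back with \<open>vapp\<close>, and a graph stores nothing outside
  \<open>X\<close>. Equalities between members of \<open>check_set\<close> are reduced to
  this.\<close>

lemma vgraph_eq_iff:
  assumes "small elts X"
  shows "vgraph elts X f = vgraph elts X g \<longleftrightarrow> (\<forall>x \<in> X. f x = g x)"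
proof
  assume "vgraph elts X f = vgraph elts X g"
  then show "\<forall>x \<in> X. f x = g x"
    by (metis assms vapp_vgraph)
next
  assume "\<forall>x \<in> X. f x = g x"
  then have "(\<lambda>x. vpair elts x (f x)) ` X = (\<lambda>x. vpair elts x (g x)) ` X"
    by (auto intro!: image_cong)
  then show "vgraph elts X f = vgraph elts X g"
    by (simp add: vgraph_def)
qed

end

section \<open>Complete atomic Boolean algebras\<close>

text \<open>With the next lemma this makes bottom and top instances of arbitrary suprema and infima,
  so that maps preserving the latter preserve the former.\<close>

lemma Sup_empty_eq_bottom: "\<Squnion>\<^bsub>L\<^esub>{} = \<bottom>\<^bsub>L\<^esub>"
  by (simp add: Lattice.sup_def bottom_def)

lemma Inf_empty_eq_top: "\<Sqinter>\<^bsub>L\<^esub>{} = \<top>\<^bsub>L\<^esub>"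
  by (simp add: Lattice.inf_def top_def)

context caba
begin

lemma At_carrier: "a \<in> At B \<Longrightarrow> a \<in> carrier B"
  by (simp add: At_def)

lemma le_bottom: "x \<sqsubseteq> \<bottom> \<Longrightarrow> x = \<bottom>"
  using le_carrier[of x \<bottom>] by auto

lemma atom_not_le_bottom: "a \<in> At B \<Longrightarrow> \<not> a \<sqsubseteq> \<bottom>"
  using le_bottom by (auto simp: At_def)

lemma atom_le_atom: "a \<in> At B \<Longrightarrow> b \<in> At B \<Longrightarrow> a \<sqsubseteq> b \<Longrightarrow> a = b"
  by (auto simp: At_def)

text \<open>The carrier premises of \<open>meet_le\<close> follow from
  \<open>le_carrier\<close>.\<close>

lemma le_meetI: "z \<sqsubseteq> x \<Longrightarrow> z \<sqsubseteq> y \<Longrightarrow> z \<sqsubseteq> x \<sqinter> y"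
  using le_carrier[of z x] le_carrier[of z y] by (simp add: meet_le)

lemma le_transitive: "x \<sqsubseteq> y \<Longrightarrow> y \<sqsubseteq> z \<Longrightarrow> x \<sqsubseteq> z"
  using le_carrier[of x y] le_carrier[of y z] le_trans[of x y z] by simp

lemma complementE:
  assumes "x \<in> carrier B"
  obtains y where "y \<in> carrier B" "x \<sqinter> y = \<bottom>" "x \<squnion> y = \<top>"
  using complemented[OF assms] by (auto simp: is_complement_def)

text \<open>Distributing \<open>x\<close> over \<open>y \<squnion> z = \<top>\<close> leaves only
  its part in \<open>z\<close>. With complements for \<open>y\<close> and \<open>z\<close>, this
  turns disjointness into an inequality.\<close>

lemma le_of_disjoint:
  assumes "x \<in> carrier B" "y \<in> carrier B" "z \<in> carrier B" "x \<sqinter> y = \<bottom>" "y \<squnion> z = \<top>"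
  shows "x \<sqsubseteq> z"
proof -
  have "x \<sqsubseteq> x \<sqinter> (y \<squnion> z)"
    using assms by (intro le_meetI) simp_all
  also have "x \<sqinter> (y \<squnion> z) = \<bottom> \<squnion> (x \<sqinter> z)"
    using distrib[OF assms(1-3)] assms(4) by simp
  also have "\<dots> \<sqsubseteq> z"
    using assms by (intro join_le) (simp_all add: meet_right)
  finally show ?thesis using assms by simp
qed

text \<open>An atom below no member of \<open>S\<close> is disjoint from all of them, so its
  complement bounds \<open>S\<close> and hence lies above the atom itself. The complement takes the
  place of an infinite distributive law.\<close>

lemma atom_le_SupD:
  assumes a: "a \<in> At B" and S: "S \<subseteq> carrier B" and le: "a \<sqsubseteq> \<Squnion>S"
  shows "\<exists>s \<in> S. a \<sqsubseteq> s"
proof (rule ccontr)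
  assume neg: "\<not> ?thesis"
  note aB = At_carrier[OF a]
  obtain c where c: "c \<in> carrier B" "a \<sqinter> c = \<bottom>" "a \<squnion> c = \<top>"
    using complementE[OF aB] .
  have "s \<sqsubseteq> c" if s: "s \<in> S" for s
  proof (rule le_of_disjoint)
    show "s \<in> carrier B" using s S by (rule subsetD[rotated])
    then have sa: "s \<sqinter> a \<in> carrier B" "s \<sqinter> a \<sqsubseteq> a" "s \<sqinter> a \<sqsubseteq> s"
      using aB by (simp_all add: meet_left meet_right)
    \<comment> \<open>Equality would put \<open>a\<close> below \<open>s\<close>, against
      \<open>neg\<close>; minimality of the atom then forces the meet to be bottom.\<close>
    then have "s \<sqinter> a \<noteq> a"
      using s neg by metis
    then show "s \<sqinter> a = \<bottom>"
      using a sa(1,2) unfolding At_def by fast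
  qed (use aB c in auto)
  then have "\<Squnion>S \<sqsubseteq> c"
    using S c by (intro weak.sup_least) simp_all
  then have "a \<sqsubseteq> a \<sqinter> c"
    using le_meetI[OF le_refl[OF aB] le_transitive[OF le]] by simp
  then show False
    using c atom_not_le_bottom[OF a] by simp
qed

lemma atom_le_joinD:
  assumes "a \<in> At B" "x \<in> carrier B" "y \<in> carrier B" "a \<sqsubseteq> x \<squnion> y"
  shows "a \<sqsubseteq> x \<or> a \<sqsubseteq> y"
  using atom_le_SupD[of a "{x, y}"] assms by (auto simp: join_def)

text \<open>If \<open>x\<close> met the complement of \<open>y\<close>, atomicity would give an atom
  below both; being below \<open>x\<close> it would also be below \<open>y\<close>, hence below
  bottom.\<close>

lemma le_iff_atoms:
  assumes x: "x \<in> carrier B" and y: "y \<in> carrier B"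
  shows "x \<sqsubseteq> y \<longleftrightarrow> (\<forall>a \<in> At B. a \<sqsubseteq> x \<longrightarrow> a \<sqsubseteq> y)"
proof
  assume "x \<sqsubseteq> y"
  then show "\<forall>a \<in> At B. a \<sqsubseteq> x \<longrightarrow> a \<sqsubseteq> y"
    using le_transitive[OF _ \<open>x \<sqsubseteq> y\<close>] by simp
next
  assume *: "\<forall>a \<in> At B. a \<sqsubseteq> x \<longrightarrow> a \<sqsubseteq> y"
  obtain c where c: "c \<in> carrier B" "y \<sqinter> c = \<bottom>" "y \<squnion> c = \<top>"
    using complementE[OF y] .
  have "x \<sqinter> c = \<bottom>"
  proof (rule ccontr)
    assume "x \<sqinter> c \<noteq> \<bottom>"
    then obtain a where a: "a \<in> At B" "a \<sqsubseteq> x \<sqinter> c"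
      using atomic[of "x \<sqinter> c"] x c by auto
    then have "a \<sqsubseteq> x" "a \<sqsubseteq> c"
      using x c le_transitive[OF a(2)] by (simp_all add: meet_left meet_right)
    then have "a \<sqsubseteq> y \<sqinter> c"
      using * a(1) by (simp add: le_meetI)
    then show False
      using c atom_not_le_bottom[OF a(1)] by simp
  qed
  moreover have "c \<squnion> y = \<top>"
    using c join_comm[of B c y] by simp
  ultimately show "x \<sqsubseteq> y"
    using x y c le_of_disjoint[of x c y] by simp
qed

text \<open>An atom below the supremum lies below some member of \<open>S\<close>, which is itself
  an atom and so equal to it. This makes every set of atoms the set of atoms below some
  element.\<close>

lemma atom_le_Sup_atoms_iff:
  assumes "S \<subseteq> At B" "a \<in> At B"
  shows "a \<sqsubseteq> \<Squnion>S \<longleftrightarrow> a \<in> S"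
proof
  have S: "S \<subseteq> carrier B" using assms At_carrier by blast
  show "a \<in> S" if "a \<sqsubseteq> \<Squnion>S"
    using atom_le_SupD[OF assms(2) S that] atom_le_atom[OF assms(2)] assms(1) by (metis subsetD)
  show "a \<in> S \<Longrightarrow> a \<sqsubseteq> \<Squnion>S"
    using weak.sup_upper[OF S] .
qed

end

section \<open>Complete Boolean homomorphisms\<close>

lemma complete_boolean_homI:
  assumes "complete_lattice B" "complete_lattice B'" "\<sigma> \<in> carrier B \<rightarrow> carrier B'"
    and Sup: "\<And>A. A \<subseteq> carrier B \<Longrightarrow> \<sigma> (\<Squnion>\<^bsub>B\<^esub>A) = \<Squnion>\<^bsub>B'\<^esub>(\<sigma> ` A)"
    and Inf: "\<And>A. A \<subseteq> carrier B \<Longrightarrow> \<sigma> (\<Sqinter>\<^bsub>B\<^esub>A) = \<Sqinter>\<^bsub>B'\<^esub>(\<sigma> ` A)"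
  shows "complete_boolean_hom B B' \<sigma>"
proof -
  have "is_complement B' (\<sigma> x) (\<sigma> y)" if "is_complement B x y" for x y
  proof -
    \<comment> \<open>Meet and join are the infimum and supremum of a pair, and bottom and top are
      those of the empty set, so complements are carried along by \<open>Sup\<close> and
      \<open>Inf\<close>.\<close>
    from that have x: "x \<in> carrier B" "y \<in> carrier B"
      and meet: "\<Sqinter>\<^bsub>B\<^esub>{x, y} = \<Squnion>\<^bsub>B\<^esub>{}" and join: "\<Squnion>\<^bsub>B\<^esub>{x, y} = \<Sqinter>\<^bsub>B\<^esub>{}"
      by (auto simp: is_complement_def meet_def join_def Sup_empty_eq_bottom Inf_empty_eq_top)
    have "\<Sqinter>\<^bsub>B'\<^esub>{\<sigma> x, \<sigma> y} = \<Squnion>\<^bsub>B'\<^esub>{}"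
      using Inf[of "{x, y}"] Sup[of "{}"] x meet by simp
    moreover have "\<Squnion>\<^bsub>B'\<^esub>{\<sigma> x, \<sigma> y} = \<Sqinter>\<^bsub>B'\<^esub>{}"
      using Sup[of "{x, y}"] Inf[of "{}"] x join by simp
    ultimately show ?thesis
      using x assms(3)
      by (auto simp: is_complement_def meet_def join_def Sup_empty_eq_bottom Inf_empty_eq_top)
  qed
  then show ?thesis
    using assms by (auto simp: complete_boolean_hom_def sup_pres_def inf_pres_def)
qed

lemma complete_boolean_homD:
  assumes "complete_boolean_hom B B' \<sigma>"
  shows "x \<in> carrier B \<Longrightarrow> \<sigma> x \<in> carrier B'"
    and "A \<subseteq> carrier B \<Longrightarrow> \<sigma> (\<Squnion>\<^bsub>B\<^esub>A) = \<Squnion>\<^bsub>B'\<^esub>(\<sigma> ` A)"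
    and "A \<subseteq> carrier B \<Longrightarrow> \<sigma> (\<Sqinter>\<^bsub>B\<^esub>A) = \<Sqinter>\<^bsub>B'\<^esub>(\<sigma> ` A)"
  using assms by (auto simp: complete_boolean_hom_def sup_pres_def inf_pres_def)

lemma complete_boolean_hom_mono:
  assumes hom: "complete_boolean_hom B B' \<sigma>"
    and xy: "x \<in> carrier B" "y \<in> carrier B" "x \<sqsubseteq>\<^bsub>B\<^esub> y"
  shows "\<sigma> x \<sqsubseteq>\<^bsub>B'\<^esub> \<sigma> y"
proof -
  have "\<sigma> \<in> carrier B \<rightarrow> carrier B'" "join_pres B B' \<sigma>"
    using hom by (auto simp: complete_boolean_hom_def intro: sup_pres_is_join_pres weak_sup_pres)
  then have "isotone B B' \<sigma>"
    by (rule join_pres_isotone)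
  then show ?thesis
    using xy by (rule use_iso2)
qed

lemma complete_boolean_hom_ident:
  assumes "complete_lattice B"
  shows "complete_boolean_hom B B (\<lambda>x \<in> carrier B. x)"
proof -
  interpret complete_lattice B by fact
  have "(\<lambda>x \<in> carrier B. x) ` A = A" if "A \<subseteq> carrier B" for A
    using that by (auto simp: image_iff subset_iff)
  then show ?thesis
    using assms by (intro complete_boolean_homI) auto
qed

lemma complete_boolean_hom_compose:
  assumes f: "complete_boolean_hom A B f" and g: "complete_boolean_hom B C g"
  shows "complete_boolean_hom A C (compose (carrier A) g f)"
proof -
  have "complete_lattice A" "complete_lattice C"
    using f g by (auto simp: complete_boolean_hom_def sup_pres_def)
  then interpret A: complete_lattice A by simp
  have im: "compose (carrier A) g f ` S = g ` f ` S" if "S \<subseteq> carrier A" for S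
    unfolding image_image using that by (intro image_cong) (auto simp: compose_def)
  have sub: "f ` S \<subseteq> carrier B" if "S \<subseteq> carrier A" for S
    using that complete_boolean_homD(1)[OF f] by blast
  show ?thesis
  proof (rule complete_boolean_homI)
    show "compose (carrier A) g f \<in> carrier A \<rightarrow> carrier C"
      using complete_boolean_homD(1)[OF f] complete_boolean_homD(1)[OF g]
      by (simp add: compose_def)
  qed (fact | simp add: im compose_eq complete_boolean_homD(2,3)[OF f]
      complete_boolean_homD(2,3)[OF g sub])+
qed

text \<open>The image of the supremum of \<open>A\<close> bounds the image of \<open>A\<close>, and
  conversely the preimage of the supremum of the image bounds \<open>A\<close>. Antisymmetry joins
  the two inequalities; infima are dual.\<close>

lemma order_iso_complete_boolean_hom:
  assumes "complete_lattice B" "complete_lattice B'"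
    and bij: "bij_betw \<sigma> (carrier B) (carrier B')"
    and iso: "\<And>x y. x \<in> carrier B \<Longrightarrow> y \<in> carrier B \<Longrightarrow> \<sigma> x \<sqsubseteq>\<^bsub>B'\<^esub> \<sigma> y \<longleftrightarrow> x \<sqsubseteq>\<^bsub>B\<^esub> y"
  shows "complete_boolean_hom B B' \<sigma>"
proof -
  interpret B: complete_lattice B by fact
  interpret B': complete_lattice B' by fact
  have \<sigma>: "\<sigma> x \<in> carrier B'" if "x \<in> carrier B" for x
    using bij that by (auto simp: bij_betw_def)
  have surj: "\<exists>x \<in> carrier B. y = \<sigma> x" if "y \<in> carrier B'" for y
    using bij that by (auto simp: bij_betw_def)
  show ?thesis
  proof (rule complete_boolean_homI)
    fix A assume A: "A \<subseteq> carrier B"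
    then have \<sigma>A: "\<sigma> ` A \<subseteq> carrier B'" using \<sigma> by blast
    obtain s where s: "s \<in> carrier B" "\<Squnion>\<^bsub>B'\<^esub>(\<sigma> ` A) = \<sigma> s"
      using surj B'.weak.sup_closed[OF \<sigma>A] by blast
    obtain i where i: "i \<in> carrier B" "\<Sqinter>\<^bsub>B'\<^esub>(\<sigma> ` A) = \<sigma> i"
      using surj B'.weak.inf_closed[OF \<sigma>A] by blast
    have "a \<sqsubseteq>\<^bsub>B\<^esub> s" "i \<sqsubseteq>\<^bsub>B\<^esub> a" if "a \<in> A" for a
      using that A s i B'.weak.sup_upper[OF \<sigma>A, of "\<sigma> a"] B'.weak.inf_lower[OF \<sigma>A, of "\<sigma> a"] iso
      by auto
    then have "\<Squnion>\<^bsub>B\<^esub>A \<sqsubseteq>\<^bsub>B\<^esub> s" "i \<sqsubseteq>\<^bsub>B\<^esub> \<Sqinter>\<^bsub>B\<^esub>A"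
      using A s i by (auto intro: B.weak.sup_least B.weak.inf_greatest)
    moreover have "\<Squnion>\<^bsub>B'\<^esub>(\<sigma> ` A) \<sqsubseteq>\<^bsub>B'\<^esub> \<sigma> (\<Squnion>\<^bsub>B\<^esub>A)"
      using A \<sigma>A \<sigma> iso[OF subsetD[OF A]] B.weak.sup_upper[OF A] by (intro B'.weak.sup_least) auto
    moreover have "\<sigma> (\<Sqinter>\<^bsub>B\<^esub>A) \<sqsubseteq>\<^bsub>B'\<^esub> \<Sqinter>\<^bsub>B'\<^esub>(\<sigma> ` A)"
      using A \<sigma>A \<sigma> iso[OF _ subsetD[OF A]] B.weak.inf_lower[OF A] by (intro B'.weak.inf_greatest) auto
    ultimately show "\<sigma> (\<Squnion>\<^bsub>B\<^esub>A) = \<Squnion>\<^bsub>B'\<^esub>(\<sigma> ` A)" "\<sigma> (\<Sqinter>\<^bsub>B\<^esub>A) = \<Sqinter>\<^bsub>B'\<^esub>(\<sigma> ` A)"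
      using A s i \<sigma> iso by (auto intro!: B'.le_antisym)
  qed (use assms \<sigma> in auto)
qed

text \<open>The atom is \<open>\<Sqinter>{b. y \<sqsubseteq> \<sigma> b}\<close>.\<close>

lemma complete_boolean_hom_atom:
  assumes "caba B" "caba B'" and hom: "complete_boolean_hom B B' \<sigma>" and y: "y \<in> At B'"
  shows "\<exists>x \<in> At B. \<forall>b \<in> carrier B. y \<sqsubseteq>\<^bsub>B'\<^esub> \<sigma> b \<longleftrightarrow> x \<sqsubseteq>\<^bsub>B\<^esub> b"
proof -
  interpret B: caba B by fact
  interpret B': caba B' by fact
  note \<sigma> = complete_boolean_homD[OF hom]
  define S where "S = {b \<in> carrier B. y \<sqsubseteq>\<^bsub>B'\<^esub> \<sigma> b}"
  define x where "x = \<Sqinter>\<^bsub>B\<^esub>S"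
  have S: "S \<subseteq> carrier B" by (auto simp: S_def)
  then have x: "x \<in> carrier B" by (simp add: x_def)
  \<comment> \<open>As \<sigma> preserves infima, \<open>\<sigma> x\<close> is the infimum of the
    images of members of \<open>S\<close>, all of which lie above \<open>y\<close>. Thus
    \<open>x\<close> is the least element whose image is above \<open>y\<close>.\<close>
  have y\<sigma>x: "y \<sqsubseteq>\<^bsub>B'\<^esub> \<sigma> x"
    unfolding x_def \<sigma>(3)[OF S]
    using \<sigma>(1) B'.At_carrier[OF y] by (intro B'.weak.inf_greatest) (auto simp: S_def)
  have iff: "y \<sqsubseteq>\<^bsub>B'\<^esub> \<sigma> b \<longleftrightarrow> x \<sqsubseteq>\<^bsub>B\<^esub> b" if b: "b \<in> carrier B" for b
  proof
    assume "y \<sqsubseteq>\<^bsub>B'\<^esub> \<sigma> b"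
    then show "x \<sqsubseteq>\<^bsub>B\<^esub> b"
      unfolding x_def using b by (intro B.weak.inf_lower[OF S]) (simp add: S_def)
  next
    assume "x \<sqsubseteq>\<^bsub>B\<^esub> b"
    then show "y \<sqsubseteq>\<^bsub>B'\<^esub> \<sigma> b"
      using y\<sigma>x complete_boolean_hom_mono[OF hom x b] B'.le_transitive by blast
  qed
  have \<sigma>_bot: "\<sigma> \<bottom>\<^bsub>B\<^esub> = \<bottom>\<^bsub>B'\<^esub>"
    using \<sigma>(2)[of "{}"] by (simp add: Sup_empty_eq_bottom)
  have \<sigma>_top: "\<sigma> \<top>\<^bsub>B\<^esub> = \<top>\<^bsub>B'\<^esub>"
    using \<sigma>(3)[of "{}"] by (simp add: Inf_empty_eq_top)
  have "x \<noteq> \<bottom>\<^bsub>B\<^esub>"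
    using y\<sigma>x \<sigma>_bot B'.atom_not_le_bottom[OF y] by auto
  moreover have "z = \<bottom>\<^bsub>B\<^esub> \<or> z = x" if z: "z \<in> carrier B" "z \<sqsubseteq>\<^bsub>B\<^esub> x" for z
  proof -
    \<comment> \<open>The images of \<open>z\<close> and its complement \<open>c\<close> join to
      top, so the atom \<open>y\<close> is below one of them. By \<open>iff\<close>,
      \<open>x\<close> is below \<open>z\<close> or \<open>c\<close>; the second case makes
      \<open>z\<close> disjoint from itself.\<close>
    obtain c where c: "c \<in> carrier B" "z \<sqinter>\<^bsub>B\<^esub> c = \<bottom>\<^bsub>B\<^esub>" "z \<squnion>\<^bsub>B\<^esub> c = \<top>\<^bsub>B\<^esub>"
      using B.complementE[OF z(1)] .
    have "\<sigma> z \<squnion>\<^bsub>B'\<^esub> \<sigma> c = \<top>\<^bsub>B'\<^esub>"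
      using \<sigma>(2)[of "{z, c}"] z c \<sigma>_top by (simp add: join_def)
    then have "y \<sqsubseteq>\<^bsub>B'\<^esub> \<sigma> z \<or> y \<sqsubseteq>\<^bsub>B'\<^esub> \<sigma> c"
      using B'.At_carrier[OF y] z c \<sigma>(1) by (intro B'.atom_le_joinD[OF y]) auto
    then have "x \<sqsubseteq>\<^bsub>B\<^esub> z \<or> x \<sqsubseteq>\<^bsub>B\<^esub> c"
      using iff z c by blast
    then show ?thesis
    proof
      assume "x \<sqsubseteq>\<^bsub>B\<^esub> z"
      then show ?thesis using x z B.le_antisym by blast
    next
      assume "x \<sqsubseteq>\<^bsub>B\<^esub> c"
      then have "z \<sqsubseteq>\<^bsub>B\<^esub> z \<sqinter>\<^bsub>B\<^esub> c"
        using z B.le_meetI[OF B.le_refl[OF z(1)] B.le_transitive[OF z(2)]] by simp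
      then show ?thesis using c B.le_bottom by auto
    qed
  qed
  ultimately have "x \<in> At B"
    using x by (auto simp: At_def)
  then show ?thesis using iff by blast
qed


section \<open>Power set algebras\<close>

context set_universe
begin

lemma carrier_powalg: "carrier (powalg elts X) = {M. elts M \<subseteq> X}"
  by (simp add: powalg_def)

lemma small_carrier_powalg: "small elts X \<Longrightarrow> small elts (carrier (powalg elts X))"
  by (simp add: carrier_powalg small_powerset)

lemma le_powalg: "M \<sqsubseteq>\<^bsub>powalg elts X\<^esub> N \<longleftrightarrow> elts M \<subseteq> elts N \<and> elts N \<subseteq> X"
  by (simp add: powalg_def)

lemma vset_in_powalg: "small elts X \<Longrightarrow> S \<subseteq> X \<Longrightarrow> vset elts S \<in> carrier (powalg elts X)"
  by (simp add: carrier_powalg elts_vset small_subset)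

lemma elts_vset_subset: "small elts X \<Longrightarrow> S \<subseteq> X \<Longrightarrow> elts (vset elts S) = S"
  by (simp add: elts_vset small_subset)

lemma partial_order_powalg: "partial_order (powalg elts X)"
proof
  show "(.=\<^bsub>powalg elts X\<^esub>) = (=)"
    by (simp add: powalg_def)
qed (auto simp: powalg_def intro: extensionality)

lemma powalg_lub:
  assumes "small elts X" "A \<subseteq> carrier (powalg elts X)"
  shows "is_lub (powalg elts X) (vset elts (\<Union>(elts ` A))) A"
proof -
  have A: "\<Union>(elts ` A) \<subseteq> X"
    using assms(2) by (auto simp: carrier_powalg)
  show ?thesis
    using assms(2) A elts_vset_subset[OF assms(1) A]
    by (intro least_UpperI) (fastforce simp: carrier_powalg le_powalg Upper_def)+
qed

text \<open>Taking the intersection inside \<open>X\<close> keeps it small and gives the empty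
  family the infimum \<open>X\<close>.\<close>

lemma powalg_glb:
  assumes "small elts X" "A \<subseteq> carrier (powalg elts X)"
  shows "is_glb (powalg elts X) (vset elts {x \<in> X. \<forall>M \<in> A. x \<in> elts M}) A"
proof -
  have A: "{x \<in> X. \<forall>M \<in> A. x \<in> elts M} \<subseteq> X"
    by blast
  show ?thesis
    using assms(2) A elts_vset_subset[OF assms(1) A]
    by (intro greatest_LowerI) (fastforce simp: carrier_powalg le_powalg Lower_def)+
qed

lemma complete_lattice_powalg:
  assumes "small elts X"
  shows "complete_lattice (powalg elts X)"
  using powalg_lub[OF assms] powalg_glb[OF assms]
  by (intro partial_order.complete_latticeI[OF partial_order_powalg]) blast+

text \<open>The supremum operator is a choice; antisymmetry makes least upper bounds unique and so
  identifies its value with the union.\<close>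

lemma Sup_powalg:
  assumes "small elts X" "A \<subseteq> carrier (powalg elts X)"
  shows "\<Squnion>\<^bsub>powalg elts X\<^esub>A = vset elts (\<Union>(elts ` A))"
proof -
  interpret complete_lattice "powalg elts X"
    by (rule complete_lattice_powalg[OF assms(1)])
  show ?thesis
    using least_unique[OF weak.sup_lub[OF assms(2)] powalg_lub[OF assms]] .
qed

lemma Inf_powalg:
  assumes "small elts X" "A \<subseteq> carrier (powalg elts X)"
  shows "\<Sqinter>\<^bsub>powalg elts X\<^esub>A = vset elts {x \<in> X. \<forall>M \<in> A. x \<in> elts M}"
proof -
  interpret complete_lattice "powalg elts X"
    by (rule complete_lattice_powalg[OF assms(1)])
  show ?thesis
    using greatest_unique[OF weak.inf_glb[OF assms(2)] powalg_glb[OF assms]] .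
qed

lemma bottom_powalg: "small elts X \<Longrightarrow> \<bottom>\<^bsub>powalg elts X\<^esub> = vset elts {}"
  using Sup_powalg[of X "{}"] by (simp add: Sup_empty_eq_bottom)

lemma top_powalg: "small elts X \<Longrightarrow> \<top>\<^bsub>powalg elts X\<^esub> = vset elts X"
  using Inf_powalg[of X "{}"] by (simp add: Inf_empty_eq_top)

lemma join_powalg:
  assumes "small elts X" "elts M \<subseteq> X" "elts N \<subseteq> X"
  shows "M \<squnion>\<^bsub>powalg elts X\<^esub> N = vset elts (elts M \<union> elts N)"
  using Sup_powalg[of X "{M, N}"] assms by (simp add: join_def carrier_powalg)

lemma meet_powalg:
  assumes "small elts X" "elts M \<subseteq> X" "elts N \<subseteq> X"
  shows "M \<sqinter>\<^bsub>powalg elts X\<^esub> N = vset elts (elts M \<inter> elts N)"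
proof -
  have "{x \<in> X. \<forall>K \<in> {M, N}. x \<in> elts K} = elts M \<inter> elts N"
    using assms by auto
  then show ?thesis
    using Inf_powalg[of X "{M, N}"] assms by (simp add: meet_def carrier_powalg)
qed

text \<open>A nonempty \<open>M\<close> contains some \<open>x\<close>, and minimality applied to
  the singleton of \<open>x\<close> leaves nothing else in \<open>M\<close>.\<close>

lemma At_powalg:
  assumes X: "small elts X"
  shows "At (powalg elts X) = (\<lambda>x. vset elts {x}) ` X"
proof (intro Set.set_eqI iffI)
  fix M assume "M \<in> At (powalg elts X)"
  then have M: "elts M \<subseteq> X" "M \<noteq> vset elts {}"
    and min: "\<And>N. elts N \<subseteq> elts M \<Longrightarrow> N = vset elts {} \<or> N = M"
    unfolding At_def bottom_powalg[OF X] carrier_powalg le_powalg by blast+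
  have "elts M \<noteq> {}"
    using M(2) vset_elts[of M] by auto
  then obtain x where x: "x \<in> elts M"
    by blast
  have "vset elts {x} = vset elts {} \<or> vset elts {x} = M"
    using x by (intro min) (simp add: elts_vset small_singleton)
  then show "M \<in> (\<lambda>x. vset elts {x}) ` X"
    using x M by (auto simp: vset_eq_iff small_singleton small_empty)
next
  fix M assume "M \<in> (\<lambda>x. vset elts {x}) ` X"
  then obtain x where x: "x \<in> X" "M = vset elts {x}"
    by blast
  have "N = vset elts {} \<or> N = vset elts {x}" if "elts N \<subseteq> {x}" for N
    using that vset_elts[of N] by (auto dest!: subset_singletonD)
  then show "M \<in> At (powalg elts X)"
    using x by (auto simp: At_def bottom_powalg[OF X] carrier_powalg le_powalg vset_eq_iff
        elts_vset small_singleton small_empty)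
qed

text \<open>All sets involved are subsets of \<open>X\<close> and hence small, so each law becomes a
  set identity. \<open>le_carrier\<close> holds because the order of \<open>powalg\<close> itself
  demands that the larger set lie in \<open>X\<close>.\<close>

lemma caba_powalg:
  assumes X: "small elts X"
  shows "caba (powalg elts X)"
proof -
  interpret complete_lattice "powalg elts X"
    by (rule complete_lattice_powalg[OF X])
  have small: "small elts S" if "S \<subseteq> X" for S
    using small_subset[OF X that] .
  note [simp] = carrier_powalg le_powalg bottom_powalg[OF X] top_powalg[OF X]
    join_powalg[OF X] meet_powalg[OF X] le_infI1 elts_vset small
  show ?thesis
  proof
    fix L M N
    assume "L \<in> carrier (powalg elts X)" "M \<in> carrier (powalg elts X)" "N \<in> carrier (powalg elts X)"
    then show "L \<sqinter>\<^bsub>powalg elts X\<^esub> (M \<squnion>\<^bsub>powalg elts X\<^esub> N) =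
        L \<sqinter>\<^bsub>powalg elts X\<^esub> M \<squnion>\<^bsub>powalg elts X\<^esub> (L \<sqinter>\<^bsub>powalg elts X\<^esub> N)"
      by (simp add: Int_Un_distrib)
  next
    fix M assume M: "M \<in> carrier (powalg elts X)"
    then have "is_complement (powalg elts X) M (vset elts (X - elts M))"
      by (simp add: is_complement_def Un_absorb1)
    then show "\<exists>N. is_complement (powalg elts X) M N" ..
    assume "M \<noteq> \<bottom>\<^bsub>powalg elts X\<^esub>"
    \<comment> \<open>An \<open>M\<close> without members would be \<open>vset elts {}\<close>,
      which is the bottom element.\<close>
    then have "elts M \<noteq> {}"
      using vset_elts[of M] by auto
    then obtain x where "x \<in> elts M"
      by blast
    then show "\<exists>a \<in> At (powalg elts X). a \<sqsubseteq>\<^bsub>powalg elts X\<^esub> M"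
      using M by (auto simp: At_powalg[OF X] small_singleton)
  qed auto
qed

section \<open>The categories of sets and of complete atomic Boolean algebras\<close>

lemma Hom_SET_iff: "h \<in> Hom (SET elts) X Y \<longleftrightarrow>
    (\<exists>f. h = Arrow X f Y \<and> small elts X \<and> small elts Y \<and> f \<in> X \<rightarrow>\<^sub>E Y)"
  by (auto simp: Hom_def SET_def)

lemma Hom_SETE:
  assumes "h \<in> Hom (SET elts) X Y"
  obtains f where "h = Arrow X f Y" "small elts X" "small elts Y" "f \<in> X \<rightarrow>\<^sub>E Y"
  using assms by (auto simp: Hom_SET_iff)

lemma Obj_SET: "X \<in> Obj (SET elts) \<longleftrightarrow> small elts X"
  by (simp add: SET_def)

lemma Ident_SET: "Ident (SET elts) X = Arrow X (\<lambda>x \<in> X. x) X"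
  by (simp add: SET_def)

lemma Comp_SET: "Comp (SET elts) (Arrow Y g Z) (Arrow X f Y') = Arrow X (compose X g f) Z"
  by (simp add: SET_def)

lemma category_SET: "category (SET elts)"
proof
  fix f g X Y Z assume "f \<in> Hom (SET elts) X Y" "g \<in> Hom (SET elts) Y Z"
  then show "Comp (SET elts) g f \<in> Hom (SET elts) X Z"
    by (auto simp: Hom_SET_iff Comp_SET compose_def PiE_def Pi_iff elim!: Hom_SETE)
next
  fix f g h W X Y Z
  assume "f \<in> Hom (SET elts) W X" "g \<in> Hom (SET elts) X Y" "h \<in> Hom (SET elts) Y Z"
  then show "Comp (SET elts) h (Comp (SET elts) g f) = Comp (SET elts) (Comp (SET elts) h g) f"
    by (auto simp: Comp_SET PiE_def intro!: compose_assoc elim!: Hom_SETE)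
next
  fix f X Y assume "f \<in> Hom (SET elts) X Y"
  then show "Comp (SET elts) f (Ident (SET elts) X) = f" "Comp (SET elts) (Ident (SET elts) Y) f = f"
    by (auto simp: Comp_SET Ident_SET PiE_def intro!: compose_Id Id_compose elim!: Hom_SETE)
qed (auto simp: SET_def Hom_def)

lemma SET_iso_arrowI:
  assumes h: "Arrow X f Y \<in> Hom (SET elts) X Y" and bij: "bij_betw f X Y"
  shows "iso_arrow (SET elts) (Arrow X f Y)"
proof -
  \<comment> \<open>The inverse is restricted because functions of arrows must be
    extensional.\<close>
  have "Arrow Y (restrict (inv_into X f) Y) X \<in> Hom (SET elts) Y X"
    using h bij by (auto simp: Hom_SET_iff bij_betw_def inv_into_into)
  then show ?thesis
    using h bij by (auto simp: iso_arrow_iff[OF h] Comp_SET Ident_SET compose_inv_into_id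
        compose_id_inv_into bij_betw_def intro!: bexI[of _ "Arrow Y (restrict (inv_into X f) Y) X"])
qed

section \<open>The category of complete atomic Boolean algebras\<close>

lemma Hom_CABA_iff: "h \<in> Hom (CABA elts) B B' \<longleftrightarrow>
    (\<exists>\<sigma>. h = Arrow B \<sigma> B' \<and> small elts (carrier B) \<and> caba B \<and> small elts (carrier B') \<and> caba B' \<and>
       \<sigma> \<in> extensional (carrier B) \<and> complete_boolean_hom B B' \<sigma>)"
  by (auto simp: Hom_def CABA_def)

lemma Hom_CABAE:
  assumes "h \<in> Hom (CABA elts) B B'"
  obtains \<sigma> where "h = Arrow B \<sigma> B'" "small elts (carrier B)" "caba B"
    "small elts (carrier B')" "caba B'" "\<sigma> \<in> extensional (carrier B)" "complete_boolean_hom B B' \<sigma>"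
  using assms by (auto simp: Hom_CABA_iff)

lemma Obj_CABA: "B \<in> Obj (CABA elts) \<longleftrightarrow> small elts (carrier B) \<and> caba B"
  by (simp add: CABA_def)

lemma Ident_CABA: "Ident (CABA elts) B = Arrow B (\<lambda>x \<in> carrier B. x) B"
  by (simp add: CABA_def)

lemma Comp_CABA: "Comp (CABA elts) (Arrow B g C) (Arrow A f B') = Arrow A (compose (carrier A) g f) C"
  by (simp add: CABA_def)

lemma complete_boolean_hom_funcset: "complete_boolean_hom B B' \<sigma> \<Longrightarrow> \<sigma> \<in> carrier B \<rightarrow> carrier B'"
  by (simp add: complete_boolean_hom_def)

lemma category_CABA: "category (CABA elts)"
proof
  fix X assume "X \<in> Obj (CABA elts)"
  then show "Ident (CABA elts) X \<in> Hom (CABA elts) X X"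
    by (auto simp: Obj_CABA Hom_CABA_iff Ident_CABA caba_def intro: complete_boolean_hom_ident)
next
  fix f g X Y Z assume "f \<in> Hom (CABA elts) X Y" "g \<in> Hom (CABA elts) Y Z"
  then show "Comp (CABA elts) g f \<in> Hom (CABA elts) X Z"
    by (auto simp: Hom_CABA_iff Comp_CABA intro: complete_boolean_hom_compose elim!: Hom_CABAE)
next
  fix f g h W X Y Z
  assume "f \<in> Hom (CABA elts) W X" "g \<in> Hom (CABA elts) X Y" "h \<in> Hom (CABA elts) Y Z"
  then show "Comp (CABA elts) h (Comp (CABA elts) g f) = Comp (CABA elts) (Comp (CABA elts) h g) f"
    by (auto simp: Comp_CABA compose_assoc complete_boolean_hom_funcset elim!: Hom_CABAE)
next
  fix f X Y assume "f \<in> Hom (CABA elts) X Y"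
  then show "Comp (CABA elts) f (Ident (CABA elts) X) = f"
      "Comp (CABA elts) (Ident (CABA elts) Y) f = f"
    by (auto simp: Comp_CABA Ident_CABA elim!: Hom_CABAE
        intro!: compose_Id Id_compose complete_boolean_hom_funcset)
qed (auto simp: CABA_def Hom_def)

text \<open>The inverse of an order isomorphism is an order isomorphism, so
  \<open>order_iso_complete_boolean_hom\<close> supplies the homomorphism in both
  directions.\<close>

lemma CABA_iso_arrowI:
  assumes B: "small elts (carrier B)" "caba B" and B': "small elts (carrier B')" "caba B'"
    and ext: "\<sigma> \<in> extensional (carrier B)" and bij: "bij_betw \<sigma> (carrier B) (carrier B')"
    and iso: "\<And>x y. x \<in> carrier B \<Longrightarrow> y \<in> carrier B \<Longrightarrow> \<sigma> x \<sqsubseteq>\<^bsub>B'\<^esub> \<sigma> y \<longleftrightarrow> x \<sqsubseteq>\<^bsub>B\<^esub> y"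
  shows "Arrow B \<sigma> B' \<in> Hom (CABA elts) B B'" and "iso_arrow (CABA elts) (Arrow B \<sigma> B')"
proof -
  have cl: "complete_lattice B" "complete_lattice B'"
    using B B' by (auto simp: caba_def)
  show h: "Arrow B \<sigma> B' \<in> Hom (CABA elts) B B'"
    using B B' ext order_iso_complete_boolean_hom[OF cl bij iso] by (simp add: Hom_CABA_iff)
  define \<tau> where "\<tau> = restrict (inv_into (carrier B) \<sigma>) (carrier B')"
  have \<tau>: "bij_betw \<tau> (carrier B') (carrier B)"
    using bij_betw_inv_into[OF bij] unfolding \<tau>_def by (simp cong: bij_betw_cong)
  have \<sigma>\<tau>: "\<sigma> (\<tau> y) = y" if "y \<in> carrier B'" for y
    using bij that by (simp add: \<tau>_def bij_betw_inv_into_right)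
  have \<tau>_carrier: "\<tau> y \<in> carrier B" if "y \<in> carrier B'" for y
    using \<tau> that by (auto simp: bij_betw_def)
  have "\<tau> x \<sqsubseteq>\<^bsub>B\<^esub> \<tau> y \<longleftrightarrow> x \<sqsubseteq>\<^bsub>B'\<^esub> y" if "x \<in> carrier B'" "y \<in> carrier B'" for x y
    using iso[of "\<tau> x" "\<tau> y"] that by (simp add: \<sigma>\<tau> \<tau>_carrier)
  then have "complete_boolean_hom B' B \<tau>"
    by (rule order_iso_complete_boolean_hom[OF cl(2,1) \<tau>])
  then have "Arrow B' \<tau> B \<in> Hom (CABA elts) B' B"
    using B B' by (simp add: Hom_CABA_iff \<tau>_def)
  moreover have "compose (carrier B) \<tau> \<sigma> = (\<lambda>x \<in> carrier B. x)"
    "compose (carrier B') \<sigma> \<tau> = (\<lambda>x \<in> carrier B'. x)"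
    using bij unfolding \<tau>_def
    by (auto simp: bij_betw_def intro: compose_inv_into_id compose_id_inv_into)
  ultimately show "iso_arrow (CABA elts) (Arrow B \<sigma> B')"
    unfolding iso_arrow_iff[OF h]
    by (intro bexI[of _ "Arrow B' \<tau> B"]) (simp_all add: Comp_CABA Ident_CABA)
qed

section \<open>The power set functor\<close>

lemma PF_Arrow: "AMap (PF elts) (Arrow X f Y) =
    Arrow (powalg elts Y) (\<lambda>M \<in> carrier (powalg elts Y). vset elts {x \<in> X. f x \<in> elts M}) (powalg elts X)"
  by (simp add: PF_def)

lemma OMap_PF: "OMap (PF elts) = powalg elts"
  by (simp add: PF_def)

text \<open>Preimages commute with arbitrary unions and intersections.\<close>

lemma PF_Hom:
  assumes h: "h \<in> Hom (SET elts) X Y"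
  shows "AMap (PF elts) h \<in> Hom (CABA elts) (powalg elts Y) (powalg elts X)"
proof -
  obtain f where h: "h = Arrow X f Y" and X: "small elts X" and Y: "small elts Y" and f: "f \<in> X \<rightarrow>\<^sub>E Y"
    using h by (rule Hom_SETE)
  define \<sigma> where "\<sigma> = (\<lambda>M \<in> carrier (powalg elts Y). vset elts {x \<in> X. f x \<in> elts M})"
  interpret Y: complete_lattice "powalg elts Y"
    by (rule complete_lattice_powalg[OF Y])
  have \<sigma>: "\<sigma> M = vset elts {x \<in> X. f x \<in> elts M}" if "M \<in> carrier (powalg elts Y)" for M
    using that by (simp add: \<sigma>_def)
  have \<sigma>_carrier: "\<sigma> M \<in> carrier (powalg elts X)" if "M \<in> carrier (powalg elts Y)" for M
    using that by (auto simp: \<sigma> intro: vset_in_powalg[OF X])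
  have elts_\<sigma>: "elts (\<sigma> M) = {x \<in> X. f x \<in> elts M}" if "M \<in> carrier (powalg elts Y)" for M
    using that by (auto simp: \<sigma> elts_vset_subset[OF X])
  have "complete_boolean_hom (powalg elts Y) (powalg elts X) \<sigma>"
  proof (rule complete_boolean_homI)
    fix A assume A: "A \<subseteq> carrier (powalg elts Y)"
    then have \<sigma>A: "\<sigma> ` A \<subseteq> carrier (powalg elts X)"
      using \<sigma>_carrier by blast
    have elts_\<sigma>A: "elts (\<sigma> M) = {x \<in> X. f x \<in> elts M}" if "M \<in> A" for M
      using elts_\<sigma> A that by blast
    have "(\<Union>M \<in> A. elts M) \<subseteq> Y"
      using A by (auto simp: carrier_powalg)
    then have Sup: "elts (\<Squnion>\<^bsub>powalg elts Y\<^esub>A) = (\<Union>M \<in> A. elts M)"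
      by (simp add: Sup_powalg[OF Y A] elts_vset_subset[OF Y])
    have Inf: "elts (\<Sqinter>\<^bsub>powalg elts Y\<^esub>A) = {y \<in> Y. \<forall>M \<in> A. y \<in> elts M}"
      by (simp add: Inf_powalg[OF Y A] elts_vset_subset[OF Y])
    have "{x \<in> X. f x \<in> elts (\<Squnion>\<^bsub>powalg elts Y\<^esub>A)} = \<Union>(elts ` \<sigma> ` A)"
      by (auto simp: Sup elts_\<sigma>A)
    then show "\<sigma> (\<Squnion>\<^bsub>powalg elts Y\<^esub>A) = \<Squnion>\<^bsub>powalg elts X\<^esub>(\<sigma> ` A)"
      by (simp add: Sup_powalg[OF X \<sigma>A] \<sigma>[OF Y.weak.sup_closed[OF A]])
    \<comment> \<open>For empty \<open>A\<close> the left side is the preimage of \<open>Y\<close>;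
      it equals \<open>X\<close> only because \<open>f\<close> maps \<open>X\<close> into
      \<open>Y\<close>.\<close>
    have "{x \<in> X. f x \<in> elts (\<Sqinter>\<^bsub>powalg elts Y\<^esub>A)} = {x \<in> X. \<forall>M \<in> \<sigma> ` A. x \<in> elts M}"
      using f by (auto simp: Inf elts_\<sigma>A)
    then show "\<sigma> (\<Sqinter>\<^bsub>powalg elts Y\<^esub>A) = \<Sqinter>\<^bsub>powalg elts X\<^esub>(\<sigma> ` A)"
      by (simp add: Inf_powalg[OF X \<sigma>A] \<sigma>[OF Y.weak.inf_closed[OF A]])
  qed (use \<sigma>_carrier complete_lattice_powalg X Y in auto)
  moreover have "AMap (PF elts) h = Arrow (powalg elts Y) \<sigma> (powalg elts X)"
    by (simp add: h PF_Arrow \<sigma>_def)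
  ultimately show ?thesis
    by (simp add: Hom_CABA_iff small_carrier_powalg caba_powalg X Y \<sigma>_def)
qed

lemma contravariant_functor_PF: "contravariant_functor (SET elts) (CABA elts) (PF elts)"
proof (intro contravariant_functor.intro category_SET category_CABA contravariant_functor_axioms.intro)
  fix X assume "X \<in> Obj (SET elts)"
  then have X: "small elts X" by (simp add: Obj_SET)
  then show "OMap (PF elts) X \<in> Obj (CABA elts)"
    by (simp add: OMap_PF Obj_CABA small_carrier_powalg caba_powalg)
  have "vset elts {x \<in> X. (\<lambda>x \<in> X. x) x \<in> elts M} = M" if "M \<in> carrier (powalg elts X)" for M
  proof -
    have "{x \<in> X. (\<lambda>x \<in> X. x) x \<in> elts M} = elts M"
      using that by (auto simp: carrier_powalg)
    then show ?thesis by (simp only: vset_elts)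
  qed
  then show "AMap (PF elts) (Ident (SET elts) X) = Ident (CABA elts) (OMap (PF elts) X)"
    by (simp add: Ident_SET Ident_CABA PF_Arrow OMap_PF cong: restrict_cong)
next
  fix h X Y assume "h \<in> Hom (SET elts) X Y"
  then show "AMap (PF elts) h \<in> Hom (CABA elts) (OMap (PF elts) Y) (OMap (PF elts) X)"
    by (simp add: OMap_PF PF_Hom)
next
  fix h k X Y Z assume "h \<in> Hom (SET elts) X Y" "k \<in> Hom (SET elts) Y Z"
  then obtain f g where h: "h = Arrow X f Y" and k: "k = Arrow Y g Z"
    and X: "small elts X" and Y: "small elts Y" and f: "f \<in> X \<rightarrow>\<^sub>E Y"
    by (auto elim!: Hom_SETE)
  have "elts (vset elts {y \<in> Y. g y \<in> elts M}) = {y \<in> Y. g y \<in> elts M}" for M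
    by (intro elts_vset_subset[OF Y]) blast
  \<comment> \<open>The conjunct \<open>f x \<in> Y\<close> appears because the inner preimage under
    \<open>g\<close> is formed inside \<open>Y\<close>.\<close>
  moreover have "{x \<in> X. compose X g f x \<in> elts M} = {x \<in> X. f x \<in> Y \<and> g (f x) \<in> elts M}" for M
    using f by (auto simp: compose_def)
  moreover have "vset elts {y \<in> Y. g y \<in> elts M} \<in> carrier (powalg elts Y)" for M
    by (auto intro: vset_in_powalg[OF Y])
  ultimately show "AMap (PF elts) (Comp (SET elts) k h)
      = Comp (CABA elts) (AMap (PF elts) h) (AMap (PF elts) k)"
    by (simp add: h k Comp_SET Comp_CABA PF_Arrow compose_def cong: restrict_cong)
qed

section \<open>The atom functor\<close>

lemma OMap_AF: "OMap (AF elts) = check_set elts"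
  by (simp add: AF_def)

lemma AF_Arrow: "AMap (AF elts) (Arrow B \<sigma> B') =
    Arrow (check_set elts B') (\<lambda>\<phi> \<in> check_set elts B'. vgraph elts (carrier B) (\<lambda>b. vapp elts \<phi> (\<sigma> b)))
      (check_set elts B)"
  by (simp add: AF_def)

lemma check_in_check_set: "x \<in> At B \<Longrightarrow> check elts B x \<in> check_set elts B"
  by (simp add: check_set_def)

lemma vapp_check:
  assumes "small elts (carrier B)" "b \<in> carrier B"
  shows "vapp elts (check elts B x) b = (if x \<sqsubseteq>\<^bsub>B\<^esub> b then vone elts else vzero elts)"
  using assms by (simp add: check_def vapp_vgraph)

lemma check_eq_iff:
  assumes "small elts (carrier B)"
  shows "check elts B x = check elts B y \<longleftrightarrow> (\<forall>b \<in> carrier B. x \<sqsubseteq>\<^bsub>B\<^esub> b \<longleftrightarrow> y \<sqsubseteq>\<^bsub>B\<^esub> b)"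
  using assms vone_neq_vzero by (auto simp: check_def vgraph_eq_iff split: if_splits)

text \<open>Evaluating the two equal maps at one of the atoms puts the other atom below it, and
  comparable atoms coincide.\<close>

lemma inj_on_check:
  assumes "small elts (carrier B)" "caba B"
  shows "inj_on (check elts B) (At B)"
proof (rule inj_onI)
  interpret caba B by fact
  fix x y assume "x \<in> At B" "y \<in> At B" "check elts B x = check elts B y"
  then show "x = y"
    using assms(1) At_carrier by (auto simp: check_eq_iff intro: atom_le_atom)
qed

lemma small_check_set:
  assumes "small elts (carrier B)"
  shows "small elts (check_set elts B)"
  unfolding check_set_def by (rule small_image[OF small_subset[OF assms]]) (auto simp: At_def)

text \<open>This translates the equation between \<open>check y\<close> composed with \<sigma> and
  \<open>check x\<close> into the relation provided by \<open>complete_boolean_hom_atom\<close>. It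
  relies on zero and one being distinct.\<close>

lemma vgraph_check_hom:
  assumes "small elts (carrier B)" "small elts (carrier B')" "complete_boolean_hom B B' \<sigma>"
  shows "vgraph elts (carrier B) (\<lambda>b. vapp elts (check elts B' y) (\<sigma> b)) = check elts B x \<longleftrightarrow>
    (\<forall>b \<in> carrier B. y \<sqsubseteq>\<^bsub>B'\<^esub> \<sigma> b \<longleftrightarrow> x \<sqsubseteq>\<^bsub>B\<^esub> b)"
  using assms vone_neq_vzero
  by (auto simp: check_def[of _ B] vgraph_eq_iff vapp_check complete_boolean_homD(1) split: if_splits)

text \<open>Both facts are stated for the same atom: the value shows that \<open>AF\<close> lands in
  \<open>check_set\<close>, and the equivalence drives the naturality proof on algebras.\<close>

lemma AF_check:
  assumes h: "Arrow B \<sigma> B' \<in> Hom (CABA elts) B B'" and y: "y \<in> At B'"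
  shows "\<exists>x \<in> At B. (\<forall>b \<in> carrier B. y \<sqsubseteq>\<^bsub>B'\<^esub> \<sigma> b \<longleftrightarrow> x \<sqsubseteq>\<^bsub>B\<^esub> b) \<and>
    fn (AMap (AF elts) (Arrow B \<sigma> B')) (check elts B' y) = check elts B x"
proof -
  have B: "small elts (carrier B)" "caba B" "small elts (carrier B')" "caba B'"
    and hom: "complete_boolean_hom B B' \<sigma>"
    using h by (auto simp: Hom_CABA_iff)
  obtain x where x: "x \<in> At B" "\<forall>b \<in> carrier B. y \<sqsubseteq>\<^bsub>B'\<^esub> \<sigma> b \<longleftrightarrow> x \<sqsubseteq>\<^bsub>B\<^esub> b"
    using complete_boolean_hom_atom[OF B(2,4) hom y] by blast
  then have "vgraph elts (carrier B) (\<lambda>b. vapp elts (check elts B' y) (\<sigma> b)) = check elts B x"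
    by (simp add: vgraph_check_hom[OF B(1,3) hom])
  then show ?thesis
    using x by (intro bexI[of _ x]) (simp_all add: AF_Arrow check_in_check_set y)
qed

lemma AF_Hom:
  assumes h: "h \<in> Hom (CABA elts) B B'"
  shows "AMap (AF elts) h \<in> Hom (SET elts) (check_set elts B') (check_set elts B)"
proof -
  obtain \<sigma> where \<sigma>: "h = Arrow B \<sigma> B'" and B: "small elts (carrier B)" "small elts (carrier B')"
    using h by (auto elim: Hom_CABAE)
  have "fn (AMap (AF elts) h) \<phi> \<in> check_set elts B" if \<phi>: "\<phi> \<in> check_set elts B'" for \<phi>
  proof -
    obtain y where y: "y \<in> At B'" "\<phi> = check elts B' y"
      using \<phi> by (auto simp: check_set_def)
    obtain x where "x \<in> At B" "fn (AMap (AF elts) h) (check elts B' y) = check elts B x"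
      using AF_check[OF h[unfolded \<sigma>] y(1)] unfolding \<sigma> by blast
    then show ?thesis
      using y by (simp add: check_in_check_set)
  qed
  then show ?thesis
    by (auto simp: Hom_SET_iff \<sigma> AF_Arrow small_check_set B)
qed

lemma contravariant_functor_AF: "contravariant_functor (CABA elts) (SET elts) (AF elts)"
proof (intro contravariant_functor.intro category_SET category_CABA contravariant_functor_axioms.intro)
  fix B assume "B \<in> Obj (CABA elts)"
  then have B: "small elts (carrier B)" "caba B"
    by (simp_all add: Obj_CABA)
  then show "OMap (AF elts) B \<in> Obj (SET elts)"
    by (simp add: OMap_AF Obj_SET small_check_set)
  \<comment> \<open>A member of \<open>check_set\<close> is a graph, and rebuilding a graph from its
    values returns it.\<close>
  have "vgraph elts (carrier B) (\<lambda>b. vapp elts \<phi> ((\<lambda>b \<in> carrier B. b) b)) = \<phi>"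
    if "\<phi> \<in> check_set elts B" for \<phi>
    using that by (auto simp: check_set_def check_def vgraph_eq_iff vapp_vgraph B)
  then show "AMap (AF elts) (Ident (CABA elts) B) = Ident (SET elts) (OMap (AF elts) B)"
    by (simp add: Ident_SET Ident_CABA AF_Arrow OMap_AF cong: restrict_cong)
next
  fix h B B' assume "h \<in> Hom (CABA elts) B B'"
  then show "AMap (AF elts) h \<in> Hom (SET elts) (OMap (AF elts) B') (OMap (AF elts) B)"
    by (simp add: OMap_AF AF_Hom)
next
  fix h k A B C assume hk: "h \<in> Hom (CABA elts) A B" "k \<in> Hom (CABA elts) B C"
  then obtain f g where h: "h = Arrow A f B" and k: "k = Arrow B g C"
    and A: "small elts (carrier A)" and B: "small elts (carrier B)" and f: "complete_boolean_hom A B f"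
    by (auto elim!: Hom_CABAE)
  let ?k = "\<lambda>\<phi>. vgraph elts (carrier B) (\<lambda>b. vapp elts \<phi> (g b))"
  \<comment> \<open>The second factor of the composite is restricted to
    \<open>check_set elts B\<close>, so its argument has to be shown to lie there.\<close>
  have "?k \<phi> \<in> check_set elts B" if "\<phi> \<in> check_set elts C" for \<phi>
    using AF_Hom[OF hk(2)] that by (auto simp: k AF_Arrow Hom_SET_iff PiE_iff)
  moreover have "vgraph elts (carrier A) (\<lambda>a. vapp elts \<phi> (compose (carrier A) g f a))
      = vgraph elts (carrier A) (\<lambda>a. vapp elts (?k \<phi>) (f a))" for \<phi>
    by (simp add: vgraph_eq_iff[OF A] vapp_vgraph[OF B] complete_boolean_homD(1)[OF f] compose_eq)
  ultimately have "(\<lambda>\<phi> \<in> check_set elts C. vgraph elts (carrier A) (\<lambda>a. vapp elts \<phi> (compose (carrier A) g f a)))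
      = compose (check_set elts C)
          (\<lambda>\<phi> \<in> check_set elts B. vgraph elts (carrier A) (\<lambda>a. vapp elts \<phi> (f a)))
          (\<lambda>\<phi> \<in> check_set elts C. ?k \<phi>)"
    unfolding compose_def[of "check_set elts C"] by (intro restrict_ext) simp
  then show "AMap (AF elts) (Comp (CABA elts) k h)
      = Comp (SET elts) (AMap (AF elts) h) (AMap (AF elts) k)"
    by (simp only: h k Comp_SET Comp_CABA AF_Arrow)
qed

section \<open>The duality\<close>

text \<open>The component at \<open>X\<close> is a composite of two bijections, from points to
  singleton atoms and from atoms to their \<open>check\<close> maps. For naturality, both paths send
  \<open>x\<close> to the graph that asks of \<open>M\<close> whether \<open>f x\<close> belongs to
  it.\<close>

lemma AP_naturally_isomorphic_id:
  "naturally_isomorphic (SET elts) (SET elts) (comp_functor (AF elts) (PF elts)) id_functor"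
proof -
  define \<eta> where "\<eta> X = (\<lambda>x \<in> X. check elts (powalg elts X) (vset elts {x}))" for X
  define H where "H X = Arrow X (\<eta> X) (check_set elts (powalg elts X))" for X
  have \<eta>_le: "vset elts {x} \<sqsubseteq>\<^bsub>powalg elts X\<^esub> M \<longleftrightarrow> x \<in> elts M"
    if "M \<in> carrier (powalg elts X)" for x M X
    using that by (simp add: le_powalg carrier_powalg elts_vset small_singleton)
  have bij: "bij_betw (\<eta> X) X (check_set elts (powalg elts X))" if X: "small elts X" for X
  proof -
    have "bij_betw (\<lambda>x. vset elts {x}) X (At (powalg elts X))"
      by (auto simp: bij_betw_def inj_on_def At_powalg[OF X] vset_eq_iff small_singleton)
    moreover have "bij_betw (check elts (powalg elts X)) (At (powalg elts X)) (check_set elts (powalg elts X))"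
      by (simp add: bij_betw_def check_set_def inj_on_check small_carrier_powalg caba_powalg X)
    ultimately have "bij_betw (check elts (powalg elts X) \<circ> (\<lambda>x. vset elts {x})) X (check_set elts (powalg elts X))"
      by (rule bij_betw_trans)
    then show ?thesis
      by (rule bij_betw_cong[THEN iffD1, rotated]) (simp add: \<eta>_def)
  qed
  have H_Hom: "H X \<in> Hom (SET elts) X (check_set elts (powalg elts X))" if X: "small elts X" for X
    using bij[OF X] X
    by (auto simp: H_def Hom_SET_iff small_check_set small_carrier_powalg \<eta>_def bij_betw_def)
  have H_iso: "iso_arrow (SET elts) (H X)" if X: "small elts X" for X
    using SET_iso_arrowI[OF H_Hom[OF X, unfolded H_def] bij[OF X]] by (simp add: H_def)
  have nat: "Comp (SET elts) (AMap (AF elts) (AMap (PF elts) h)) (H X) = Comp (SET elts) (H Y) h"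
    if h: "h \<in> Hom (SET elts) X Y" for h X Y
  proof -
    obtain f where f: "h = Arrow X f Y" "f \<in> X \<rightarrow>\<^sub>E Y" and X: "small elts X" and Y: "small elts Y"
      using h by (auto elim: Hom_SETE)
    have "fn (AMap (AF elts) (AMap (PF elts) h)) (\<eta> X x) = \<eta> Y (f x)" if x: "x \<in> X" for x
    proof -
      have \<eta>x: "\<eta> X x \<in> check_set elts (powalg elts X)"
        using bij[OF X] x by (auto simp: bij_betw_def)
      have fx: "f x \<in> Y"
        using f x by auto
      have pre: "vset elts {x \<in> X. f x \<in> elts M} \<in> carrier (powalg elts X)"
        "elts (vset elts {x \<in> X. f x \<in> elts M}) = {x \<in> X. f x \<in> elts M}" for M
        by (blast intro: vset_in_powalg[OF X], intro elts_vset_subset[OF X], blast)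
      have "fn (AMap (AF elts) (AMap (PF elts) h)) (\<eta> X x) =
          vgraph elts (carrier (powalg elts Y))
            (\<lambda>M. vapp elts (\<eta> X x) ((\<lambda>M \<in> carrier (powalg elts Y). vset elts {x \<in> X. f x \<in> elts M}) M))"
        using \<eta>x by (simp add: f PF_Arrow AF_Arrow)
      \<comment> \<open>By \<open>\<eta>_le\<close>, at each \<open>M\<close> the left side tests
        \<open>x\<close> for membership in the preimage of \<open>M\<close>, and the right side
        tests \<open>f x\<close> for membership in \<open>M\<close>.\<close>
      also have "\<dots> = \<eta> Y (f x)"
        using x fx pre
        by (simp add: \<eta>_def check_def[of _ "powalg elts Y"] vgraph_eq_iff small_carrier_powalg[OF Y]
            vapp_check small_carrier_powalg[OF X] \<eta>_le)
      finally show ?thesis .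
    qed
    then show ?thesis
      by (simp add: H_def f PF_Arrow AF_Arrow Comp_SET compose_def cong: restrict_cong)
  qed
  show ?thesis
  proof (rule naturally_isomorphic_id_functorI[where \<eta> = H, OF category_SET])
    show "covariant_functor (SET elts) (SET elts) (comp_functor (AF elts) (PF elts))"
      by (rule covariant_comp_functor[OF contravariant_functor_PF contravariant_functor_AF])
  qed (simp_all add: comp_functor_def OMap_PF OMap_AF Obj_SET H_Hom H_iso nat)
qed

text \<open>The component at \<open>B\<close> preserves and reflects order by
  \<open>le_iff_atoms\<close>, hence is injective; it is surjective by taking suprema of sets of
  atoms.\<close>

lemma PA_naturally_isomorphic_id:
  "naturally_isomorphic (CABA elts) (CABA elts) (comp_functor (PF elts) (AF elts)) id_functor"
proof -
  define \<epsilon> where "\<epsilon> B = (\<lambda>b \<in> carrier B. vset elts (check elts B ` {x \<in> At B. x \<sqsubseteq>\<^bsub>B\<^esub> b}))" for B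
  define E where "E B = Arrow B (\<epsilon> B) (powalg elts (check_set elts B))" for B
  have sub: "check elts B ` {x \<in> At B. x \<sqsubseteq>\<^bsub>B\<^esub> b} \<subseteq> check_set elts B" for B b
    by (auto simp: check_set_def)
  have elts_\<epsilon>: "elts (\<epsilon> B b) = check elts B ` {x \<in> At B. x \<sqsubseteq>\<^bsub>B\<^esub> b}"
    if "small elts (carrier B)" "b \<in> carrier B" for B b
    using that by (simp add: \<epsilon>_def elts_vset_subset[OF small_check_set sub])
  \<comment> \<open>Injectivity of \<open>check\<close> on atoms excludes that
    \<open>check elts B x\<close> is in the image only through another atom.\<close>
  have check_\<epsilon>: "check elts B x \<in> elts (\<epsilon> B b) \<longleftrightarrow> x \<sqsubseteq>\<^bsub>B\<^esub> b"
    if "small elts (carrier B)" "caba B" "b \<in> carrier B" "x \<in> At B" for B b x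
    using that inj_on_check[of B] by (auto simp: elts_\<epsilon> inj_on_eq_iff)
  have \<epsilon>_carrier: "\<epsilon> B b \<in> carrier (powalg elts (check_set elts B))"
    if "small elts (carrier B)" "b \<in> carrier B" for B b
    using that sub by (simp add: carrier_powalg elts_\<epsilon>)
  have E: "E B \<in> Hom (CABA elts) B (powalg elts (check_set elts B)) \<and> iso_arrow (CABA elts) (E B)"
    if B: "small elts (carrier B)" "caba B" for B
  proof -
    interpret caba B by fact
    let ?P = "powalg elts (check_set elts B)"
    have iso: "\<epsilon> B b \<sqsubseteq>\<^bsub>?P\<^esub> \<epsilon> B c \<longleftrightarrow> b \<sqsubseteq>\<^bsub>B\<^esub> c" if "b \<in> carrier B" "c \<in> carrier B" for b c
    proof -
      have "\<epsilon> B b \<sqsubseteq>\<^bsub>?P\<^esub> \<epsilon> B c \<longleftrightarrow> (\<forall>x \<in> At B. x \<sqsubseteq>\<^bsub>B\<^esub> b \<longrightarrow> check elts B x \<in> elts (\<epsilon> B c))"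
        using \<epsilon>_carrier[OF B(1) that(2)] elts_\<epsilon>[OF B(1) that(1)] by (auto simp: le_powalg carrier_powalg)
      then show ?thesis
        using that by (simp add: check_\<epsilon>[OF B] le_iff_atoms)
    qed
    have "bij_betw (\<epsilon> B) (carrier B) (carrier ?P)"
    proof (rule bij_betwI')
      fix b c assume bc: "b \<in> carrier B" "c \<in> carrier B"
      show "\<epsilon> B b = \<epsilon> B c \<longleftrightarrow> b = c"
      proof
        assume eq: "\<epsilon> B b = \<epsilon> B c"
        show "b = c"
          using iso[OF bc] iso[OF bc(2,1)] iso[OF bc(1,1)] bc eq by (simp add: le_antisym)
      qed simp
    next
      fix M assume M: "M \<in> carrier ?P"
      \<comment> \<open>The set \<open>M\<close> of maps is pulled back to atoms; their supremum is
        the preimage of \<open>M\<close>, since it has exactly these atoms below it.\<close>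
      define S where "S = {x \<in> At B. check elts B x \<in> elts M}"
      have S: "S \<subseteq> carrier B" "S \<subseteq> At B"
        using At_carrier by (auto simp: S_def)
      have "{x \<in> At B. x \<sqsubseteq>\<^bsub>B\<^esub> \<Squnion>\<^bsub>B\<^esub>S} = S"
        using atom_le_Sup_atoms_iff[OF S(2)] S(2) by auto
      then have "elts (\<epsilon> B (\<Squnion>\<^bsub>B\<^esub>S)) = check elts B ` S"
        using elts_\<epsilon>[OF B(1) weak.sup_closed[OF S(1)]] by simp
      also have "\<dots> = elts M"
        using M by (auto simp: S_def carrier_powalg check_set_def)
      finally have "M = \<epsilon> B (\<Squnion>\<^bsub>B\<^esub>S)"
        using extensionality by simp
      then show "\<exists>b \<in> carrier B. M = \<epsilon> B b"
        using weak.sup_closed[OF S(1)] by (rule bexI)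
    qed (rule \<epsilon>_carrier[OF B(1)])
    then show ?thesis
      unfolding E_def using B iso
      by (intro conjI CABA_iso_arrowI)
        (simp_all add: \<epsilon>_def small_carrier_powalg caba_powalg small_check_set)
  qed
  have nat: "Comp (CABA elts) (AMap (PF elts) (AMap (AF elts) h)) (E B) = Comp (CABA elts) (E B') h"
    if h: "h \<in> Hom (CABA elts) B B'" for h B B'
  proof -
    obtain \<sigma> where \<sigma>: "h = Arrow B \<sigma> B'" and B: "small elts (carrier B)" "caba B"
      and B': "small elts (carrier B')" "caba B'" and hom: "complete_boolean_hom B B' \<sigma>"
      using h by (auto elim: Hom_CABAE)
    let ?f = "fn (AMap (AF elts) h)"
    have "vset elts {\<phi> \<in> check_set elts B'. ?f \<phi> \<in> elts (\<epsilon> B b)} = \<epsilon> B' (\<sigma> b)"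
      if b: "b \<in> carrier B" for b
    proof -
      have \<sigma>b: "\<sigma> b \<in> carrier B'"
        by (rule complete_boolean_homD(1)[OF hom b])
      \<comment> \<open>\<open>AF_check\<close> replaces the left-hand map by
        \<open>check elts B x\<close> for the atom \<open>x\<close> associated with
        \<open>y\<close>, and then both conditions say that \<open>x\<close> is below
        \<open>b\<close>.\<close>
      have "?f (check elts B' y) \<in> elts (\<epsilon> B b) \<longleftrightarrow> y \<sqsubseteq>\<^bsub>B'\<^esub> \<sigma> b" if y: "y \<in> At B'" for y
        using AF_check[OF h[unfolded \<sigma>] y] check_\<epsilon>[OF B b] b unfolding \<sigma> by metis
      then have "{\<phi> \<in> check_set elts B'. ?f \<phi> \<in> elts (\<epsilon> B b)} = check elts B' ` {y \<in> At B'. y \<sqsubseteq>\<^bsub>B'\<^esub> \<sigma> b}"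
        by (auto simp: check_set_def)
      then show ?thesis
        using \<sigma>b by (simp add: \<epsilon>_def)
    qed
    \<comment> \<open>Exposing the source and target of \<open>AMap (AF elts) h\<close> lets
      \<open>PF_Arrow\<close> rewrite the outer functor.\<close>
    moreover obtain g where "AMap (AF elts) h = Arrow (check_set elts B') g (check_set elts B)"
      using AF_Hom[OF h] by (auto elim: Hom_SETE)
    ultimately show ?thesis
      using \<epsilon>_carrier[OF B(1)]
      by (simp add: E_def \<sigma> PF_Arrow Comp_CABA compose_def cong: restrict_cong)
  qed
  show ?thesis
  proof (rule naturally_isomorphic_id_functorI[where \<eta> = E, OF category_CABA])
    show "covariant_functor (CABA elts) (CABA elts) (comp_functor (PF elts) (AF elts))"
      by (rule covariant_comp_functor[OF contravariant_functor_AF contravariant_functor_PF])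
  qed (simp_all add: comp_functor_def OMap_PF OMap_AF Obj_CABA E nat)
qed

lemma dually_quasi_inverse_PF_AF: "dually_quasi_inverse (SET elts) (CABA elts) (PF elts) (AF elts)"
  by (simp add: dually_quasi_inverse_def AP_naturally_isomorphic_id PA_naturally_isomorphic_id)

end

theorem mainTheorem12:
  fixes elts :: "'u \<Rightarrow> 'u set"
  assumes "set_universe elts"
  shows "dual_equivalence (SET elts) (CABA elts) (PF elts) \<and>
         dual_equivalence (CABA elts) (SET elts) (AF elts) \<and>
         dually_quasi_inverse (SET elts) (CABA elts) (PF elts) (AF elts)"
proof -
  interpret set_universe elts by fact
  \<comment> \<open>Each functor is the witness for the other; for \<open>AF\<close> the two natural
    isomorphisms are exchanged.\<close>
  show ?thesis
    using contravariant_functor_PF contravariant_functor_AF dually_quasi_inverse_PF_AF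
      dually_quasi_inverse_sym[OF dually_quasi_inverse_PF_AF]
    by (auto simp: dual_equivalence_def)
qed

end
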